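(* Let $r\ge 1$ and $k\ge 1$ be integers, and let $T$ be an integer sequence satisfying a homogeneous meta-Fibonacci recursion $$T(n)=\sum_{p=1}^{k} T\big(S_p(n,T_{<n})\big)\qquad (n>r)$$ with $r$ given initial values $T(1),\dots,T(r)$, where each spot function $S_p(n)=S_p(n,T_{<n})$ depends only on $n$ and the values $T(j)$, $j<n$, and satisfies $1\le S_p(n)<n$ for all $n>r$. Fix $p\in\{1,\dots,k\}$ and define the generation sequence $M_p$ by $M_p(n)=1$ for $1\le n\le r$ and $M_p(n)=M_p(S_p(n))+1$ for $n>r$. If the spot sequence $(S_p(n))_{n>r}$ is slow-growing, then $M_p$ is slow-growing.
   Context: A sequence $(x_n)$ is called slow-growing (or slow) if it is monotonically nondecreasing with $x_{n+1}-x_n\in\{0,1\}$ for all $n$ in its domain. $M_p$ is called the generation sequence of $T$ based on spot $p$. *)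

theory Defs
  imports Main
begin

text \<open>
  Sequences indexed by positive integers are functions on \<open>nat\<close>; the value at \<open>0\<close> is never used.
  A spot function receives \<open>p\<close>, \<open>n\<close> and the history \<open>[T 1, \<dots>, T (n - 1)]\<close> as a list, so that
  it depends on nothing but \<open>n\<close> and the values \<open>T j\<close> with \<open>1 \<le> j < n\<close>.
\<close>

type_synonym spot_funs = "nat \<Rightarrow> nat \<Rightarrow> int list \<Rightarrow> nat"

definition slow_growing_on :: "nat set \<Rightarrow> (nat \<Rightarrow> int) \<Rightarrow> bool" where
  "slow_growing_on D x \<longleftrightarrow>
     mono_on D x \<and> (\<forall>n. n \<in> D \<and> n + 1 \<in> D \<longrightarrow> x (n + 1) - x n \<in> {0, 1})"

definition spot_seq :: "spot_funs \<Rightarrow> (nat \<Rightarrow> int) \<Rightarrow> nat \<Rightarrow> nat \<Rightarrow> nat" where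
  "spot_seq S T p n = S p n (map T [1..<n])"

definition meta_fibonacci :: "nat \<Rightarrow> nat \<Rightarrow> spot_funs \<Rightarrow> (nat \<Rightarrow> int) \<Rightarrow> bool" where
  "meta_fibonacci r k S T \<longleftrightarrow>
     (\<forall>n>r. (\<forall>p\<in>{1..k}. 1 \<le> spot_seq S T p n \<and> spot_seq S T p n < n) \<and>
            T n = (\<Sum>p=1..k. T (spot_seq S T p n)))"

definition generation_seq :: "nat \<Rightarrow> (nat \<Rightarrow> nat) \<Rightarrow> (nat \<Rightarrow> int) \<Rightarrow> bool" where
  "generation_seq r s M \<longleftrightarrow>
     (\<forall>n\<in>{1..r}. M n = 1) \<and> (\<forall>n>r. M n = M (s n) + 1)"

lemma generation_seq_exists:
  assumes "\<And>n. n > r \<Longrightarrow> 1 \<le> s n \<and> s n < n"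
  shows "\<exists>M. generation_seq r s M"
proof -
  define F where "F = (\<lambda>(M :: nat \<Rightarrow> int) n. if n \<le> r then 1 else M (s n) + 1)"
  have "adm_wf less_than F"
    using assms by (auto simp: adm_wf_def F_def)
  then have "wfrec less_than F n = F (wfrec less_than F) n" for n
    by (metis wfrec_fixpoint wf_less_than)
  then have "generation_seq r s (wfrec less_than F)"
    unfolding generation_seq_def by (metis F_def atLeastAtMost_iff leD)
  then show ?thesis by blast
qed

lemma generation_seq_unique:
  assumes "\<And>n. n > r \<Longrightarrow> 1 \<le> s n \<and> s n < n"
    and "generation_seq r s M" "generation_seq r s M'" "1 \<le> n"
  shows "M n = M' n"
  using \<open>1 \<le> n\<close>
proof (induction n rule: less_induct)
  case (less n)
  show ?case
  proof (cases "n \<le> r")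
    case True
    then show ?thesis using less.prems assms(2,3) by (simp add: generation_seq_def)
  next
    case False
    then have "n > r" by simp
    then have "M (s n) = M' (s n)" using less.IH assms(1) by blast
    then show ?thesis using \<open>n > r\<close> assms(2,3) by (simp add: generation_seq_def)
  qed
qed

end

(* For n > r, M (n + 1) - M n = M (s (n + 1)) - M (s n).  The spots s n and
   s (n + 1) are equal or consecutive, so this difference is 0 or an increment of M at the
   smaller index s n, and strong induction applies. *)

theory Submission
  imports Defs
begin

lemma slow_growing_onI:
  assumes convex: "\<And>m n. m \<in> D \<Longrightarrow> n \<in> D \<Longrightarrow> {m..n} \<subseteq> D"
    and increment: "\<And>n. n \<in> D \<Longrightarrow> n + 1 \<in> D \<Longrightarrow> x (n + 1) - x n \<in> {0, 1}"
  shows "slow_growing_on D x"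
proof -
  have "mono_on D x"
  proof (rule mono_onI)
    fix m n
    assume "m \<in> D" "n \<in> D" "m \<le> n"
    show "x m \<le> x n"
    proof (rule lift_Suc_mono_le_ivl[where N = "{i. i \<in> D \<and> i + 1 \<in> D}"])
      show "x i \<le> x (Suc i)" if "i \<in> {i. i \<in> D \<and> i + 1 \<in> D}" for i
        using increment[of i] that by auto
      show "{m..<n} \<subseteq> {i. i \<in> D \<and> i + 1 \<in> D}"
        using convex[OF \<open>m \<in> D\<close> \<open>n \<in> D\<close>] by auto
    qed (fact \<open>m \<le> n\<close>)
  qed
  then show ?thesis
    using increment by (simp add: slow_growing_on_def)
qed

lemma slow_growing_on_increment_cases:
  assumes "slow_growing_on D x" "n \<in> D" "n + 1 \<in> D"
  obtains (steady) "x (n + 1) = x n" | (growing) "x (n + 1) = x n + 1"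
proof -
  have "x (n + 1) - x n \<in> {0, 1}"
    using assms by (simp add: slow_growing_on_def)
  then show thesis
    using steady growing by fastforce
qed

lemma generation_seq_initial:
  assumes "generation_seq r s M" "1 \<le> n" "n \<le> r"
  shows "M n = 1"
  using assms by (simp add: generation_seq_def)

lemma generation_seq_recursion:
  assumes "generation_seq r s M" "r < n"
  shows "M n = M (s n) + 1"
  using assms by (simp add: generation_seq_def)

lemma generation_seq_after_initial:
  assumes "generation_seq r s M" "1 \<le> s (r + 1)" "s (r + 1) \<le> r"
  shows "M (r + 1) = 2"
proof -
  have "M (r + 1) = M (s (r + 1)) + 1"
    using assms(1) by (rule generation_seq_recursion) simp
  also have "M (s (r + 1)) = 1"
    using assms by (rule generation_seq_initial)
  finally show ?thesis by simp
qed

lemma generation_seq_increment: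
  assumes gen: "generation_seq r s M"
    and spot: "\<And>n. r < n \<Longrightarrow> 1 \<le> s n \<and> s n < n"
    and slow: "slow_growing_on {r<..} (\<lambda>n. int (s n))"
    and "1 \<le> n"
  shows "M (n + 1) - M n \<in> {0, 1}"
  using \<open>1 \<le> n\<close>
proof (induction n rule: less_induct)
  case (less n)
  consider (initial) "n < r" | (boundary) "n = r" | (recursive) "r < n"
    by linarith
  then show ?case
  proof cases
    case initial
    then have "M n = 1" "M (n + 1) = 1"
      using generation_seq_initial[OF gen] \<open>1 \<le> n\<close> by simp_all
    then show ?thesis by simp
  next
    case boundary
    have "M n = 1"
      using generation_seq_initial[OF gen] \<open>1 \<le> n\<close> boundary by blast
    moreover have "M (n + 1) = 2"
      using generation_seq_after_initial[OF gen] spot[of "r + 1"] boundary by simp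
    ultimately show ?thesis by simp
  next
    case recursive
    then have difference: "M (n + 1) - M n = M (s (n + 1)) - M (s n)"
      using generation_seq_recursion[OF gen] by simp
    have "n \<in> {r<..}" "n + 1 \<in> {r<..}"
      using recursive by simp_all
    with slow show ?thesis
    proof (cases rule: slow_growing_on_increment_cases)
      case steady
      then show ?thesis using difference by simp
    next
      case growing
      then have "s (n + 1) = s n + 1" by simp
      moreover have "M (s n + 1) - M (s n) \<in> {0, 1}"
        using less.IH spot recursive by simp
      ultimately show ?thesis using difference by simp
    qed
  qed
qed

lemma slow_growing_on_generation_seq:
  assumes "generation_seq r s M"
    and "\<And>n. r < n \<Longrightarrow> 1 \<le> s n \<and> s n < n"
    and "slow_growing_on {r<..} (\<lambda>n. int (s n))"
  shows "slow_growing_on {1..} M"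
proof (rule slow_growing_onI)
  show "M (n + 1) - M n \<in> {0, 1}" if "n \<in> {1..}" for n
    using generation_seq_increment[OF assms] that by simp
qed auto

lemma meta_fibonacci_spot_bounds:
  assumes "meta_fibonacci r k S T" "p \<in> {1..k}" "r < n"
  shows "1 \<le> spot_seq S T p n \<and> spot_seq S T p n < n"
  using assms unfolding meta_fibonacci_def by blast

theorem theorem1:
  fixes r k p :: nat and S :: spot_funs and T M :: "nat \<Rightarrow> int"
  assumes "r \<ge> 1" and "k \<ge> 1"
    and "meta_fibonacci r k S T"
    and "p \<in> {1..k}"
    and "generation_seq r (spot_seq S T p) M"
    and "slow_growing_on {r<..} (\<lambda>n. int (spot_seq S T p n))"
  shows "slow_growing_on {1..} M"
  using \<open>generation_seq r (spot_seq S T p) M\<close>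
proof (rule slow_growing_on_generation_seq)
  show "1 \<le> spot_seq S T p n \<and> spot_seq S T p n < n" if "r < n" for n
    using \<open>meta_fibonacci r k S T\<close> \<open>p \<in> {1..k}\<close> that by (rule meta_fibonacci_spot_bounds)
  show "slow_growing_on {r<..} (\<lambda>n. int (spot_seq S T p n))" by fact
qed

end
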